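(* $[\tau(\mathbf{CInd})\mathbf{Txt}\mathbf{Psd}\mathbf{Ex}_C]_{\mathbf{REC}} \setminus [\mathbf{Txt}\mathbf{Sd}\mathbf{Bc}_W]_{\mathbf{REC}} \neq \emptyset$.
   Context: Fix an acceptable numbering $(\varphi_e)_{e\in\mathbb{N}}$ of all partial computable functions. $W_e=\mathrm{dom}(\varphi_e)$. A number $e$ is a $C$-index if $\varphi_e$ is total with values in $\{0,1\}$; then $C_e=\{x:\varphi_e(x)=1\}$. $\mathbf{REC}$ is the collection of recursive subsets of $\mathbb{N}$; $\mathcal{P}$ denotes the partial computable functions. Fix a pause symbol $\#$. A text is a total function $T:\mathbb{N}\to\mathbb{N}\cup\{\#\}$, $\mathrm{content}(T)=\mathrm{range}(T)\setminus\{\#\}$, $T$ is a text for $L$ if $\mathrm{content}(T)=L$, $T[n]=(T(0),\dots,T(n-1))$. A learner is some $h\in\mathcal{P}$ (finite sets coded as numbers). Hypothesis sequences: partially set-driven $\mathbf{Psd}(h,T)(i)=h(\mathrm{content}(T[i]),i)$; set-driven $\mathbf{Sd}(h,T)(i)=h(\mathrm{content}(T[i]))$. Restrictions on hypothesis sequence $p$ and text $T$: $\mathbf{Ex}_C$: there is $n_0$ with $p(n)=p(n_0)$ for all $n\ge n_0$ and $p(n_0)$ a $C$-index with $C_{p(n_0)}=\mathrm{content}(T)$; $\mathbf{Bc}_W$: there is $n_0$ such that $W_{p(n)}=\mathrm{content}(T)$ for all $n\ge n_0$; $\mathbf{CInd}$: for all $i$, $p(i)$ is a $C$-index. A learner $h$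 $\tau(\alpha)\mathbf{Txt}\beta\delta$-learns $L$ iff $\alpha(\beta(h,T),T)$ holds for every text $T$ whatsoever and $\delta(\beta(h,T),T)$ holds for every text $T$ for $L$ (omitting $\tau(\alpha)$ means no global requirement). $[\tau(\alpha)\mathbf{Txt}\beta\delta]_{\mathbf{REC}}$ is the set of all classes $\mathcal{L}\subseteq\mathbf{REC}$ for which some $h\in\mathcal{P}$ learns every $L\in\mathcal{L}$ in this sense. *)

theory Defs
  imports Main "HOL-Library.Nat_Bijection"
begin

section \<open>Partial computable functions\<close>

datatype recf =
    Zero
  | Succ
  | Proj nat
  | Comp recf "recf list"
  | PrimRec recf recf
  | Mu recf

text \<open>
  Programs are not arity-checked; applying one to an argument list of unsuitable length is
  just undefined (or, for \<open>Zero\<close> and \<open>Proj\<close>, still meaningful). For each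
  fixed length of the argument list this yields exactly the usual partial recursive functions.
  Composition is strict in all arguments, and minimisation requires all values below the
  minimum to be defined.
\<close>

fun eval :: "recf \<Rightarrow> nat list \<Rightarrow> nat option" where
  "eval Zero xs = Some 0"
| "eval Succ xs = (case xs of [x] \<Rightarrow> Some (Suc x) | _ \<Rightarrow> None)"
| "eval (Proj i) xs = (if i < length xs then Some (xs ! i) else None)"
| "eval (Comp f gs) xs =
     (let ys = map (\<lambda>g. eval g xs) gs
      in if None \<in> set ys then None else eval f (map the ys))"
| "eval (PrimRec f g) xs =
     (case xs of
        [] \<Rightarrow> None
      | n # ys \<Rightarrow>
          rec_nat (eval f ys) (\<lambda>k r. Option.bind r (\<lambda>v. eval g (k # v # ys))) n)"
| "eval (Mu f) xs =
     (if \<exists>z. eval f (z # xs) = Some 0 \<and> (\<forall>y<z. eval f (y # xs) \<noteq> None)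
      then Some (LEAST z. eval f (z # xs) = Some 0) else None)"

definition partial_computable :: "(nat \<Rightarrow> nat option) set" where
  "partial_computable = {f. \<exists>r. \<forall>x. eval r [x] = f x}"

definition partial_computable2 :: "(nat \<Rightarrow> nat \<Rightarrow> nat option) set" where
  "partial_computable2 = {f. \<exists>r. \<forall>x y. eval r [x, y] = f x y}"

definition total_computable :: "(nat \<Rightarrow> nat) set" where
  "total_computable = {f. (\<lambda>x. Some (f x)) \<in> partial_computable}"

definition REC :: "nat set set" where
  "REC = {L. (\<lambda>x. of_bool (x \<in> L)) \<in> total_computable}"

text \<open>
  Acceptability in the sense of Rogers: the numbering has a computable universal function and
  every computable numbering translates into it by a total computable function.
\<close>

definition acceptable_numbering :: "(nat \<Rightarrow> nat \<Rightarrow> nat option) \<Rightarrow> bool" where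
  "acceptable_numbering \<phi> \<longleftrightarrow>
     range \<phi> = partial_computable \<and>
     \<phi> \<in> partial_computable2 \<and>
     (\<forall>\<psi>\<in>partial_computable2. \<exists>f\<in>total_computable. \<forall>e. \<phi> (f e) = \<psi> e)"

definition W :: "(nat \<Rightarrow> nat \<Rightarrow> nat option) \<Rightarrow> nat \<Rightarrow> nat set" where
  "W \<phi> e = dom (\<phi> e)"

definition C_index :: "(nat \<Rightarrow> nat \<Rightarrow> nat option) \<Rightarrow> nat \<Rightarrow> bool" where
  "C_index \<phi> e \<longleftrightarrow> (\<forall>x. \<phi> e x = Some 0 \<or> \<phi> e x = Some 1)"

definition C :: "(nat \<Rightarrow> nat \<Rightarrow> nat option) \<Rightarrow> nat \<Rightarrow> nat set" where
  "C \<phi> e = {x. \<phi> e x = Some 1}"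


section \<open>Learning from text\<close>

text \<open>
  In a text, \<open>None\<close> is the pause symbol. In a learner or a hypothesis sequence,
  \<open>None\<close> means that the value is undefined.
\<close>

type_synonym text_seq = "nat \<Rightarrow> nat option"
type_synonym learner = "nat \<Rightarrow> nat option"
type_synonym hyp_seq = "nat \<Rightarrow> nat option"

definition content :: "text_seq \<Rightarrow> nat set" where
  "content T = {x. Some x \<in> range T}"

definition content_upto :: "text_seq \<Rightarrow> nat \<Rightarrow> nat set" where
  "content_upto T n = {x. Some x \<in> T ` {..<n}}"

definition Psd :: "learner \<Rightarrow> text_seq \<Rightarrow> hyp_seq" where
  "Psd h T i = h (prod_encode (set_encode (content_upto T i), i))"

definition Sd :: "learner \<Rightarrow> text_seq \<Rightarrow> hyp_seq" where
  "Sd h T i = h (set_encode (content_upto T i))"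

definition Ex_C ::
  "(nat \<Rightarrow> nat \<Rightarrow> nat option) \<Rightarrow> hyp_seq \<Rightarrow> text_seq \<Rightarrow> bool" where
  "Ex_C \<phi> p T \<longleftrightarrow>
     (\<exists>n0 e. p n0 = Some e \<and> (\<forall>n\<ge>n0. p n = p n0) \<and> C_index \<phi> e \<and> C \<phi> e = content T)"

definition Bc_W ::
  "(nat \<Rightarrow> nat \<Rightarrow> nat option) \<Rightarrow> hyp_seq \<Rightarrow> text_seq \<Rightarrow> bool" where
  "Bc_W \<phi> p T \<longleftrightarrow> (\<exists>n0. \<forall>n\<ge>n0. \<exists>e. p n = Some e \<and> W \<phi> e = content T)"

definition CInd ::
  "(nat \<Rightarrow> nat \<Rightarrow> nat option) \<Rightarrow> hyp_seq \<Rightarrow> text_seq \<Rightarrow> bool" where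
  "CInd \<phi> p T \<longleftrightarrow> (\<forall>i. \<exists>e. p i = Some e \<and> C_index \<phi> e)"

definition unrestricted :: "hyp_seq \<Rightarrow> text_seq \<Rightarrow> bool" where
  "unrestricted p T \<longleftrightarrow> True"

definition learns ::
  "(hyp_seq \<Rightarrow> text_seq \<Rightarrow> bool) \<Rightarrow> (learner \<Rightarrow> text_seq \<Rightarrow> hyp_seq) \<Rightarrow>
   (hyp_seq \<Rightarrow> text_seq \<Rightarrow> bool) \<Rightarrow> learner \<Rightarrow> nat set \<Rightarrow> bool" where
  "learns \<alpha> \<beta> \<delta> h L \<longleftrightarrow>
     (\<forall>T. \<alpha> (\<beta> h T) T) \<and> (\<forall>T. content T = L \<longrightarrow> \<delta> (\<beta> h T) T)"

definition learnable_REC ::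
  "(hyp_seq \<Rightarrow> text_seq \<Rightarrow> bool) \<Rightarrow> (learner \<Rightarrow> text_seq \<Rightarrow> hyp_seq) \<Rightarrow>
   (hyp_seq \<Rightarrow> text_seq \<Rightarrow> bool) \<Rightarrow> nat set set set" where
  "learnable_REC \<alpha> \<beta> \<delta> =
     {\<L>. \<L> \<subseteq> REC \<and> (\<exists>h\<in>partial_computable. \<forall>L\<in>\<L>. learns \<alpha> \<beta> \<delta> h L)}"

end

theory Submission
  imports Complex_Main Defs
begin

text \<open>
  For every \<open>e\<close>, search computably for some \<open>m > e\<close> such that the hypothesis
  \<open>\<phi>\<^sub>e({e..<m})\<close> is defined and enumerates \<open>m\<close>. The class contains every
  \<open>{e..}\<close>, together with \<open>{e..<m}\<close> whenever the search for \<open>e\<close> finds \<open>m\<close>.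
  If it does, the set-driven learner \<open>\<phi>\<^sub>e\<close> fails on the finite set \<open>{e..<m}\<close>; if it
  does not, none of the hypotheses \<open>\<phi>\<^sub>e({e..<m})\<close> is correct for \<open>{e..}\<close>.
  A partially set-driven learner reads off \<open>e\<close> as the minimum of the content and runs the
  search for as many steps as it has seen data, so that it eventually knows the outcome.
  It conjectures \<open>{e..<m}\<close> if \<open>m\<close> has been found and has not appeared in the data,
  and \<open>{e..}\<close> otherwise; both have uniformly computable \<open>C\<close>-indices.
\<close>

section \<open>Closure properties of total recursive functions\<close>

text \<open>Agreement is demanded on lists of length \<open>n\<close> only, so \<open>f\<close> may
  be written with \<open>!\<close>, \<open>hd\<close> and \<open>tl\<close> and exchanged by
  \<open>total_rec_cong\<close> for any function that agrees with it there.\<close>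

definition total_rec :: "nat \<Rightarrow> (nat list \<Rightarrow> nat) \<Rightarrow> bool" where
  "total_rec n f \<longleftrightarrow> (\<exists>r. \<forall>xs. length xs = n \<longrightarrow> eval r xs = Some (f xs))"

definition rec_pred :: "nat \<Rightarrow> (nat list \<Rightarrow> bool) \<Rightarrow> bool" where
  "rec_pred n P \<longleftrightarrow> total_rec n (\<lambda>xs. of_bool (P xs))"

lemma total_rec_cong:
  assumes "total_rec n f" "\<And>xs. length xs = n \<Longrightarrow> f xs = g xs"
  shows "total_rec n g"
  using assms unfolding total_rec_def by metis

lemma total_rec_Comp:
  assumes "total_rec (length gs) f" "\<forall>g\<in>set gs. total_rec n g"
  shows "total_rec n (\<lambda>xs. f (map (\<lambda>g. g xs) gs))"
proof -
  obtain r where r: "\<And>xs. length xs = length gs \<Longrightarrow> eval r xs = Some (f xs)"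
    using assms(1) unfolding total_rec_def by auto
  obtain R where R: "\<And>g xs. g \<in> set gs \<Longrightarrow> length xs = n \<Longrightarrow> eval (R g) xs = Some (g xs)"
    using bchoice[OF assms(2)[unfolded total_rec_def]] by blast
  have "eval (Comp r (map R gs)) xs = Some (f (map (\<lambda>g. g xs) gs))" if "length xs = n" for xs
  proof -
    have "map (\<lambda>g. eval g xs) (map R gs) = map (\<lambda>g. Some (g xs)) gs"
      using R that by simp
    then show ?thesis
      unfolding eval.simps Let_def by (auto simp: comp_def r R that cong: map_cong)
  qed
  then show ?thesis unfolding total_rec_def by blast
qed

lemma total_rec_proj: "i < n \<Longrightarrow> total_rec n (\<lambda>xs. xs ! i)"
  unfolding total_rec_def by (rule exI[of _ "Proj i"]) simp

lemma total_rec_unary: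
  assumes "total_rec 1 (\<lambda>xs. g (xs ! 0))" "total_rec n f"
  shows "total_rec n (\<lambda>xs. g (f xs))"
  using total_rec_Comp[of "[f]" "\<lambda>xs. g (xs ! 0)" n] assms by simp

lemma total_rec_binary:
  assumes "total_rec 2 (\<lambda>xs. g (xs ! 0) (xs ! 1))" "total_rec n f1" "total_rec n f2"
  shows "total_rec n (\<lambda>xs. g (f1 xs) (f2 xs))"
  using total_rec_Comp[of "[f1, f2]" "\<lambda>xs. g (xs ! 0) (xs ! 1)" n] assms
  by (simp add: numeral_2_eq_2)

lemma total_rec_Suc:
  assumes "total_rec n f"
  shows "total_rec n (\<lambda>xs. Suc (f xs))"
proof (rule total_rec_unary[OF _ assms])
  have "eval Succ xs = Some (Suc (xs ! 0))" if "length xs = 1" for xs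
    using that by (cases xs) auto
  then show "total_rec 1 (\<lambda>xs. Suc (xs ! 0))" unfolding total_rec_def by blast
qed

lemma total_rec_const: "total_rec n (\<lambda>_. c)"
proof (induction c)
  case 0
  show ?case unfolding total_rec_def by (rule exI[of _ Zero]) simp
next
  case (Suc c)
  then show ?case by (rule total_rec_Suc)
qed

text \<open>\<open>PrimRec\<close> takes its parameters behind the recursion argument, so computed
  arguments must be put in front of the unchanged inputs. The inputs are copied through as the
  \<open>n\<close> projections.\<close>

lemma total_rec_args:
  assumes "total_rec (length gs + n) f" "\<forall>g\<in>set gs. total_rec n g"
  shows "total_rec n (\<lambda>xs. f (map (\<lambda>g. g xs) gs @ xs))"
proof (rule total_rec_cong)
  show "total_rec n (\<lambda>xs. f (map (\<lambda>g. g xs) (gs @ map (\<lambda>i xs. xs ! i) [0..<n])))"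
    by (rule total_rec_Comp) (use assms in \<open>auto intro: total_rec_proj\<close>)
next
  fix xs :: "nat list" assume "length xs = n"
  then have "map (\<lambda>g. g xs) (map (\<lambda>i xs. xs ! i) [0..<n]) = xs"
    by (auto intro!: nth_equalityI)
  then show "f (map (\<lambda>g. g xs) (gs @ map (\<lambda>i xs. xs ! i) [0..<n])) =
      f (map (\<lambda>g. g xs) gs @ xs)"
    by simp
qed

lemma total_rec_rec_nat:
  assumes "total_rec n f" "total_rec (Suc (Suc n)) g" "total_rec n h"
  shows "total_rec n (\<lambda>xs. rec_nat (f xs) (\<lambda>k v. g (k # v # xs)) (h xs))"
proof -
  obtain rf rg where rf: "\<And>xs. length xs = n \<Longrightarrow> eval rf xs = Some (f xs)"
    and rg: "\<And>xs. length xs = Suc (Suc n) \<Longrightarrow> eval rg xs = Some (g xs)"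
    using assms(1,2) unfolding total_rec_def by auto
  have "eval (PrimRec rf rg) (m # xs) = Some (rec_nat (f xs) (\<lambda>k v. g (k # v # xs)) m)"
    if "length xs = n" for m xs
    by (induction m) (use that rf rg in auto)
  then have "total_rec (Suc n)
      (\<lambda>ys. rec_nat (f (tl ys)) (\<lambda>k v. g (k # v # tl ys)) (hd ys))"
    unfolding total_rec_def
    by (intro exI[of _ "PrimRec rf rg"] allI impI) (metis length_Suc_conv list.sel(1,3))
  from total_rec_args[of "[h]" n, simplified, OF this assms(3)] show ?thesis by simp
qed

lemma total_rec_rec_nat1:
  assumes "total_rec 2 (\<lambda>xs. g (xs ! 0) (xs ! 1))" "total_rec n h"
  shows "total_rec n (\<lambda>xs. rec_nat c g (h xs))"
proof -
  have "total_rec (Suc (Suc n)) (\<lambda>xs. g (xs ! 0) (xs ! 1))"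
    by (rule total_rec_binary[OF assms(1)]) (auto intro: total_rec_proj)
  from total_rec_rec_nat[OF total_rec_const this assms(2), of c] show ?thesis by simp
qed

lemma total_rec_add:
  assumes "total_rec n f" "total_rec n g"
  shows "total_rec n (\<lambda>xs. f xs + g xs)"
proof -
  have *: "rec_nat a (\<lambda>_. Suc) b = a + b" for a b :: nat by (induction b) auto
  have "total_rec (Suc (Suc n)) (\<lambda>xs. Suc (xs ! 1))"
    by (intro total_rec_Suc total_rec_proj) simp
  from total_rec_rec_nat[OF assms(1) this assms(2)] show ?thesis by (simp add: *)
qed

lemma total_rec_diff:
  assumes "total_rec n f" "total_rec n g"
  shows "total_rec n (\<lambda>xs. f xs - g xs)"
proof -
  \<comment> \<open>The predecessor arises from a recursion that discards the previous value and
    returns its counter.\<close>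
  have "rec_nat 0 (\<lambda>k _. k) a = a - 1" for a :: nat by (cases a) auto
  then have pred: "total_rec m h \<Longrightarrow> total_rec m (\<lambda>xs. h xs - 1)" for m h
    using total_rec_rec_nat1[of "\<lambda>k _. k" m h 0] by (simp add: total_rec_proj)
  have *: "rec_nat a (\<lambda>_ v. v - 1) b = a - b" for a b :: nat by (induction b) auto
  have "total_rec (Suc (Suc n)) (\<lambda>xs. xs ! 1 - 1)"
    by (intro pred total_rec_proj) simp
  from total_rec_rec_nat[OF assms(1) this assms(2)] * show ?thesis by simp
qed

lemma total_rec_mult:
  assumes "total_rec n f" "total_rec n g"
  shows "total_rec n (\<lambda>xs. f xs * g xs)"
proof -
  have *: "rec_nat 0 (\<lambda>_ v. v + a) b = a * b" for a b :: nat by (induction b) auto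
  have "total_rec 2 (\<lambda>xs. rec_nat 0 (\<lambda>k v. (\<lambda>ys. ys ! 1 + ys ! 2) (k # v # xs)) (xs ! 1))"
    by (intro total_rec_rec_nat total_rec_add total_rec_const total_rec_proj) auto
  then have "total_rec 2 (\<lambda>xs. xs ! 0 * xs ! 1)" by (simp add: *)
  from total_rec_binary[OF this assms] show ?thesis .
qed

section \<open>Decidable predicates, case distinction and minimisation\<close>

lemma rec_pred_le:
  assumes "total_rec n f" "total_rec n g"
  shows "rec_pred n (\<lambda>xs. f xs \<le> g xs)"
  unfolding rec_pred_def
proof (rule total_rec_cong)
  \<comment> \<open>With truncated subtraction the outer difference is 1 exactly when the inner one
    is 0.\<close>
  show "total_rec n (\<lambda>xs. 1 - (f xs - g xs))"
    by (intro total_rec_diff total_rec_const assms)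
qed auto

lemma rec_pred_not:
  assumes "rec_pred n P"
  shows "rec_pred n (\<lambda>xs. \<not> P xs)"
  unfolding rec_pred_def
proof (rule total_rec_cong)
  show "total_rec n (\<lambda>xs. 1 - of_bool (P xs))"
    using assms by (intro total_rec_diff total_rec_const) (simp add: rec_pred_def)
qed auto

lemma rec_pred_conj:
  assumes "rec_pred n P" "rec_pred n Q"
  shows "rec_pred n (\<lambda>xs. P xs \<and> Q xs)"
  unfolding rec_pred_def
proof (rule total_rec_cong)
  show "total_rec n (\<lambda>xs. of_bool (P xs) * of_bool (Q xs))"
    using assms by (intro total_rec_mult) (simp_all add: rec_pred_def)
qed auto

lemma rec_pred_disj:
  assumes "rec_pred n P" "rec_pred n Q"
  shows "rec_pred n (\<lambda>xs. P xs \<or> Q xs)"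
  using rec_pred_not[OF rec_pred_conj[OF assms[THEN rec_pred_not]]] by simp

lemma rec_pred_eq:
  assumes "total_rec n f" "total_rec n g"
  shows "rec_pred n (\<lambda>xs. f xs = g xs)"
  using rec_pred_conj[OF rec_pred_le[OF assms] rec_pred_le[OF assms(2,1)]]
  by (simp add: order_eq_iff)

lemma rec_pred_less:
  assumes "total_rec n f" "total_rec n g"
  shows "rec_pred n (\<lambda>xs. f xs < g xs)"
  using rec_pred_not[OF rec_pred_le[OF assms(2,1)]] by (simp add: not_le)

lemma total_rec_if:
  assumes "rec_pred n P" "total_rec n f" "total_rec n g"
  shows "total_rec n (\<lambda>xs. if P xs then f xs else g xs)"
proof (rule total_rec_cong)
  show "total_rec n (\<lambda>xs. of_bool (P xs) * f xs + (1 - of_bool (P xs)) * g xs)"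
    using assms unfolding rec_pred_def
    by (intro total_rec_add total_rec_mult total_rec_diff total_rec_const)
qed auto

lemma total_rec_Least:
  assumes "rec_pred (Suc n) P" "\<And>xs. length xs = n \<Longrightarrow> \<exists>z. P (z # xs)"
  shows "total_rec n (\<lambda>xs. LEAST z. P (z # xs))"
proof -
  \<comment> \<open>\<open>Mu\<close> looks for the value 0, hence the indicator of the negated
    predicate.\<close>
  obtain r where r: "\<And>xs. length xs = Suc n \<Longrightarrow> eval r xs = Some (of_bool (\<not> P xs))"
    using rec_pred_not[OF assms(1)] unfolding rec_pred_def total_rec_def by auto
  have "eval (Mu r) xs = Some (LEAST z. P (z # xs))" if "length xs = n" for xs
    using assms(2)[OF that] that by (auto simp: r)
  then show ?thesis unfolding total_rec_def by blast
qed

lemmas total_rec_intros =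
  total_rec_proj total_rec_const total_rec_Suc total_rec_add total_rec_diff total_rec_mult
  total_rec_if rec_pred_le rec_pred_less rec_pred_eq rec_pred_not rec_pred_conj rec_pred_disj

section \<open>Computing with codes of finite sets and pairs\<close>

lemma total_rec_power2:
  assumes "total_rec n f"
  shows "total_rec n (\<lambda>xs. 2 ^ f xs)"
proof -
  have *: "rec_nat 1 (\<lambda>_ v. v + v) a = (2::nat) ^ a" for a by (induction a) auto
  have "total_rec n (\<lambda>xs. rec_nat 1 (\<lambda>_ v. v + v) (f xs))"
    by (intro total_rec_rec_nat1 total_rec_intros assms) auto
  then show ?thesis by (simp only: *)
qed

text \<open>\<open>set_decode\<close> reads a number in binary, so membership is the parity after
  \<open>f xs\<close> halvings.\<close>

lemma rec_pred_bit:
  assumes "total_rec n f" "total_rec n g"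
  shows "rec_pred n (\<lambda>xs. f xs \<in> set_decode (g xs))"
proof -
  \<comment> \<open>Halving satisfies the recursion h(k + 1) = k - h(k).\<close>
  have half: "rec_nat 0 (-) a = a div 2" for a :: nat
  proof (induction a)
    case (Suc a)
    then have "rec_nat 0 (-) (Suc a) = a - a div 2" by simp
    then show ?case by presburger
  qed simp
  have total_half: "total_rec m (\<lambda>xs. h xs div 2)" if "total_rec m h" for m h
    using total_rec_rec_nat1[OF _ that, of "(-)" 0]
    by (simp add: half total_rec_intros)
  have odd: "rec_nat 0 (\<lambda>_ v. 1 - v) a = (of_bool (odd a) :: nat)" for a :: nat
    by (induction a) auto
  have shift: "rec_nat b (\<lambda>_ v. v div 2) a = b div 2 ^ a" for a b :: nat
    by (induction a) (auto simp: div_mult2_eq[symmetric] mult.commute)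
  have "total_rec n (\<lambda>xs. rec_nat (g xs) (\<lambda>k v. (\<lambda>ys. ys ! 1 div 2) (k # v # xs)) (f xs))"
    by (intro total_rec_rec_nat total_half total_rec_intros assms) simp
  then have "total_rec n (\<lambda>xs. rec_nat 0 (\<lambda>_ v. 1 - v) (g xs div 2 ^ f xs))"
    by (intro total_rec_rec_nat1 total_rec_intros) (auto simp: shift)
  then have "total_rec n (\<lambda>xs. of_bool (odd (g xs div 2 ^ f xs)))" by (simp only: odd)
  then show ?thesis by (simp add: rec_pred_def set_decode_def)
qed

lemma total_rec_triangle:
  assumes "total_rec n f"
  shows "total_rec n (\<lambda>xs. triangle (f xs))"
proof -
  have *: "rec_nat 0 (\<lambda>k v. v + Suc k) a = triangle a" for a by (induction a) auto
  have "total_rec n (\<lambda>xs. rec_nat 0 (\<lambda>k v. v + Suc k) (f xs))"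
    by (intro total_rec_rec_nat1 total_rec_intros assms) auto
  then show ?thesis by (simp only: *)
qed

lemma total_rec_prod_encode:
  assumes "total_rec n f" "total_rec n g"
  shows "total_rec n (\<lambda>xs. prod_encode (f xs, g xs))"
  unfolding prod_encode_def by (simp, intro total_rec_intros total_rec_triangle assms)

text \<open>The diagonal \<open>a + b\<close> on which \<open>(a, b)\<close> lies is recovered from the code by
  a search.\<close>

lemma diagonal_prod_encode: "(LEAST k. prod_encode (a, b) < triangle (Suc k)) = a + b"
proof (rule Least_equality)
  show "prod_encode (a, b) < triangle (Suc (a + b))" by (simp add: prod_encode_def)
  have mono: "mono triangle" by (rule mono_iff_le_Suc[THEN iffD2]) simp
  fix k assume k: "prod_encode (a, b) < triangle (Suc k)"
  show "a + b \<le> k"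
    using k monoD[OF mono, of "Suc k" "a + b"]
    by (intro leI notI) (simp add: prod_encode_def)
qed

lemma total_rec_prod_decode:
  assumes "total_rec n f"
  shows "total_rec n (\<lambda>xs. fst (prod_decode (f xs)))"
    and "total_rec n (\<lambda>xs. snd (prod_decode (f xs)))"
proof -
  \<comment> \<open>\<open>d p\<close> will be the sum of both components. Subtracting
    \<open>triangle (d p)\<close> from \<open>p\<close> leaves the first one, and subtracting that
    from \<open>d p\<close> leaves the second.\<close>
  define d where "d p = (LEAST k. p < triangle (Suc k))" for p
  have d: "d p = fst (prod_decode p) + snd (prod_decode p)" for p
    using diagonal_prod_encode[of "fst (prod_decode p)" "snd (prod_decode p)"]
    by (simp add: d_def)
  have p: "p = triangle (d p) + fst (prod_decode p)" for p
    using prod_decode_inverse[of p] unfolding d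
    by (cases "prod_decode p") (simp add: prod_encode_def)
  have fst: "fst (prod_decode p) = p - triangle (d p)" for p using p[of p] by simp
  have snd: "snd (prod_decode p) = d p - fst (prod_decode p)" for p using d[of p] by simp
  have "rec_pred (Suc 1) (\<lambda>ys. ys ! 1 < triangle (Suc (ys ! 0)))"
    by (intro total_rec_intros total_rec_triangle) auto
  moreover have "\<exists>z. p < triangle (Suc z)" for p by (rule exI[of _ p]) simp
  ultimately have "total_rec 1 (\<lambda>xs. LEAST z. (z # xs) ! 1 < triangle (Suc ((z # xs) ! 0)))"
    by (intro total_rec_Least) auto
  then have "total_rec 1 (\<lambda>xs. d (xs ! 0))" by (simp add: d_def)
  note total_d = total_rec_unary[OF this assms]
  show fst': "total_rec n (\<lambda>xs. fst (prod_decode (f xs)))"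
    unfolding fst by (intro total_rec_intros total_rec_triangle total_d assms)
  show "total_rec n (\<lambda>xs. snd (prod_decode (f xs)))"
    unfolding snd by (intro total_rec_intros total_d fst')
qed


section \<open>Clocked evaluation\<close>

text \<open>Only unbounded search needs fuel, so the clock merely bounds every minimisation.\<close>

fun clocked :: "nat \<Rightarrow> recf \<Rightarrow> nat list \<Rightarrow> nat option" where
  "clocked s Zero xs = Some 0"
| "clocked s Succ xs = (case xs of [x] \<Rightarrow> Some (Suc x) | _ \<Rightarrow> None)"
| "clocked s (Proj i) xs = (if i < length xs then Some (xs ! i) else None)"
| "clocked s (Comp f gs) xs =
     (let ys = map (\<lambda>g. clocked s g xs) gs
      in if None \<in> set ys then None else clocked s f (map the ys))"
| "clocked s (PrimRec f g) xs =
     (case xs of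
        [] \<Rightarrow> None
      | n # ys \<Rightarrow>
          rec_nat (clocked s f ys)
            (\<lambda>k r. Option.bind r (\<lambda>v. clocked s g (k # v # ys))) n)"
| "clocked s (Mu f) xs =
     (if \<exists>z<s. clocked s f (z # xs) = Some 0 \<and> (\<forall>y<z. clocked s f (y # xs) \<noteq> None)
      then Some (LEAST z. clocked s f (z # xs) = Some 0) else None)"

text \<open>Both \<open>Mu\<close> clauses are instances, with \<open>B\<close> always true or
  \<open>B z\<close> meaning \<open>z < s\<close>. The witness in the condition may lie above the
  least zero; the downward closure of \<open>B\<close> carries the bound over to that zero.\<close>

lemma search_eq_Some_iff:
  fixes F :: "nat \<Rightarrow> nat option"
  assumes "\<And>y z. y \<le> z \<Longrightarrow> B z \<Longrightarrow> B y"
  shows "(if \<exists>z. B z \<and> F z = Some 0 \<and> (\<forall>y<z. F y \<noteq> None)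
          then Some (LEAST z. F z = Some 0) else None) = Some z \<longleftrightarrow>
         B z \<and> F z = Some 0 \<and> (\<forall>y<z. \<exists>v. F y = Some (Suc v))"
    (is "?S = Some z \<longleftrightarrow> ?R")
proof
  assume S: "?S = Some z"
  then obtain z' where z': "B z'" "F z' = Some 0" "\<forall>y<z'. F y \<noteq> None"
    by (auto split: if_splits)
  from S have z: "z = (LEAST z. F z = Some 0)" by (auto split: if_splits)
  have le: "z \<le> z'" unfolding z by (rule Least_le) (rule z')
  have "\<exists>v. F y = Some (Suc v)" if "y < z" for y
  proof -
    have "F y \<noteq> None" "F y \<noteq> Some 0"
      using that le z'(3) not_less_Least[of y "\<lambda>z. F z = Some 0"] z by auto
    then show ?thesis by (metis option.exhaust old.nat.exhaust)
  qed
  moreover have "F z = Some 0" unfolding z by (rule LeastI) (rule z')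
  ultimately show ?R using assms[OF le z'(1)] by blast
next
  assume R: ?R
  then have "(LEAST z. F z = Some 0) = z"
    by (intro Least_equality leI) auto
  with R show "?S = Some z" by force
qed

lemma eval_Mu_eq_Some_iff:
  "eval (Mu f) xs = Some z \<longleftrightarrow>
   eval f (z # xs) = Some 0 \<and> (\<forall>y<z. \<exists>v. eval f (y # xs) = Some (Suc v))"
  using search_eq_Some_iff[of "\<lambda>_. True" "\<lambda>z. eval f (z # xs)"] by simp

lemma clocked_Mu_eq_Some_iff:
  "clocked s (Mu f) xs = Some z \<longleftrightarrow>
   z < s \<and> clocked s f (z # xs) = Some 0 \<and> (\<forall>y<z. \<exists>v. clocked s f (y # xs) = Some (Suc v))"
  using search_eq_Some_iff[of "\<lambda>z. z < s" "\<lambda>z. clocked s f (z # xs)"] by simp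

text \<open>Bounding a search can make a value undefined but cannot change it, so a defined clocked
  result is built from correct intermediate values.\<close>

lemma clocked_sound: "clocked s r xs = Some v \<Longrightarrow> eval r xs = Some v"
proof (induction r arbitrary: xs v)
  case (Comp f gs)
  from Comp.prems have def: "\<forall>g\<in>set gs. clocked s g xs \<noteq> None"
    and f: "clocked s f (map (\<lambda>g. the (clocked s g xs)) gs) = Some v"
    by (auto simp: Let_def comp_def image_iff split: if_splits) (metis not_None_eq)
  have eq: "eval g xs = clocked s g xs" if "g \<in> set gs" for g
    using def Comp.IH(2)[OF that] that by fastforce
  then have "map (\<lambda>g. eval g xs) gs = map (\<lambda>g. clocked s g xs) gs" by simp
  moreover have "eval f (map (\<lambda>g. the (clocked s g xs)) gs) = Some v"
    using Comp.IH(1) f by blast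
  ultimately show ?case using def eq by (auto simp: Let_def comp_def cong: map_cong)
next
  case (PrimRec f g)
  from PrimRec.prems obtain n ys where xs: "xs = n # ys" by (cases xs) auto
  have "clocked s (PrimRec f g) (n # ys) = Some v \<Longrightarrow> eval (PrimRec f g) (n # ys) = Some v" for v
    by (induction n arbitrary: v) (auto simp: PrimRec.IH bind_eq_Some_conv)
  with PrimRec.prems xs show ?case by blast
next
  case (Mu f)
  then show ?case unfolding clocked_Mu_eq_Some_iff eval_Mu_eq_Some_iff by blast
qed auto

text \<open>A halting evaluation makes finitely many subevaluations. Stating the claim for all
  sufficiently large clocks lets their thresholds be combined without a separate monotonicity
  argument.\<close>

lemma clocked_complete:
  "eval r xs = Some v \<Longrightarrow> \<forall>\<^sub>F s in sequentially. clocked s r xs = Some v"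
proof (induction r arbitrary: xs v)
  case (Comp f gs)
  from Comp.prems have def: "\<forall>g\<in>set gs. eval g xs \<noteq> None"
    and f: "eval f (map (\<lambda>g. the (eval g xs)) gs) = Some v"
    by (auto simp: Let_def comp_def image_iff split: if_splits) (metis not_None_eq)
  have "\<forall>\<^sub>F s in sequentially. \<forall>g\<in>set gs. clocked s g xs = eval g xs"
    by (rule eventually_ball_finite) (use def Comp.IH(2) in fastforce)+
  with Comp.IH(1)[OF f] show ?case
  proof eventually_elim
    case (elim s)
    from elim(2) have "map (\<lambda>g. clocked s g xs) gs = map (\<lambda>g. eval g xs) gs" by simp
    then show ?case using elim def by (auto simp: Let_def comp_def cong: map_cong)
  qed
next
  case (PrimRec f g)
  from PrimRec.prems obtain n ys where xs: "xs = n # ys" by (cases xs) auto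
  have "\<forall>\<^sub>F s in sequentially. clocked s (PrimRec f g) (n # ys) = Some v"
    if "eval (PrimRec f g) (n # ys) = Some v" for v
    using that
  proof (induction n arbitrary: v)
    case 0
    then show ?case using PrimRec.IH(1) by simp
  next
    case (Suc n)
    then obtain w where w: "eval (PrimRec f g) (n # ys) = Some w"
      and g: "eval g (n # w # ys) = Some v"
      by (auto simp: bind_eq_Some_conv)
    from Suc.IH[OF w] PrimRec.IH(2)[OF g] show ?case
      by eventually_elim simp
  qed
  with PrimRec.prems xs show ?case by blast
next
  case (Mu f)
  from Mu.prems have z: "eval f (v # xs) = Some 0"
    and y: "\<forall>y<v. \<exists>w. eval f (y # xs) = Some (Suc w)"
    unfolding eval_Mu_eq_Some_iff by auto
  have "\<forall>\<^sub>F s in sequentially. \<forall>y\<in>{..<v}. \<exists>w. clocked s f (y # xs) = Some (Suc w)"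
  proof (intro eventually_ball_finite ballI)
    fix i assume "i \<in> {..<v}"
    then obtain w where "eval f (i # xs) = Some (Suc w)" using y by auto
    from Mu.IH[OF this] show "\<forall>\<^sub>F s in sequentially. \<exists>w. clocked s f (i # xs) = Some (Suc w)"
      by eventually_elim blast
  qed simp
  with Mu.IH[OF z] eventually_gt_at_top[of v] show ?case
    by eventually_elim (unfold clocked_Mu_eq_Some_iff, auto)
qed auto

text \<open>Undefinedness becomes 0 and values are shifted by one, which turns clocked evaluation
  into a total numeric function.\<close>

abbreviation option_code :: "nat option \<Rightarrow> nat" where
  "option_code \<equiv> case_option 0 Suc"

text \<open>The state of the search below is \<open>0\<close> while searching, \<open>1\<close> after an undefined value,
  and \<open>z + 2\<close> once \<open>z\<close> has been found.\<close>

lemma option_code_clocked_Mu: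
  "option_code (clocked s (Mu f) xs) =
   rec_nat 0 (\<lambda>k v. if v \<noteq> 0 then v
                    else if option_code (clocked s f (k # xs)) = 0 then 1
                    else if option_code (clocked s f (k # xs)) = 1 then k + 2 else 0) s - 1"
    (is "_ = rec_nat 0 ?g s - 1")
proof -
  define F where "F k = clocked s f (k # xs)" for k
  define P where "P z \<longleftrightarrow> F z = Some 0 \<and> (\<forall>y<z. \<exists>v. F y = Some (Suc v))" for z
  define S where "S = rec_nat 0 ?g"
  have S_simps: "S 0 = 0" "S (Suc k) = ?g k (S k)" for k by (simp_all add: S_def)
  have inv: "(S m = 0 \<and> (\<forall>y<m. \<exists>v. F y = Some (Suc v))) \<or>
      (S m = 1 \<and> (\<exists>z<m. F z = None \<and> (\<forall>y<z. \<exists>v. F y = Some (Suc v)))) \<or>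
      (\<exists>z<m. S m = z + 2 \<and> P z)" for m
  proof (induction m)
    case (Suc m)
    show ?case
    proof (cases "S m = 0")
      case True
      then have all: "\<forall>y<m. \<exists>v. F y = Some (Suc v)" using Suc by auto
      consider "F m = None" | "F m = Some 0" | v where "F m = Some (Suc v)"
        by (metis option.exhaust old.nat.exhaust)
      then show ?thesis
        using True all by cases (auto simp: S_simps F_def[symmetric] P_def less_Suc_eq)
    next
      case False
      then show ?thesis using Suc by (auto simp: S_simps less_Suc_eq)
    qed
  qed (simp add: S_simps)
  have iff: "clocked s (Mu f) xs = Some z \<longleftrightarrow> z < s \<and> P z" for z
    unfolding clocked_Mu_eq_Some_iff P_def F_def by blast
  have none: "clocked s (Mu f) xs = None" if "\<And>z. z < s \<Longrightarrow> \<not> P z"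
    using iff that by (metis option.exhaust)
  from inv[of s] consider
      "S s = 0" "\<forall>y<s. \<exists>v. F y = Some (Suc v)"
    | z where "S s = 1" "z < s" "F z = None" "\<forall>y<z. \<exists>v. F y = Some (Suc v)"
    | z where "z < s" "S s = z + 2" "P z"
    by metis
  then have "option_code (clocked s (Mu f) xs) = S s - 1"
  proof cases
    case 1
    then have "clocked s (Mu f) xs = None" by (intro none) (auto simp: P_def)
    with 1 show ?thesis by simp
  next
    case 2
    \<comment> \<open>Below \<open>z\<close> all values are positive, at \<open>z\<close> the value
      is undefined, and above \<open>z\<close> a successful search would need a defined value at
      \<open>z\<close>.\<close>
    have "\<not> P y" for y
      using 2(3,4) by (cases y z rule: linorder_cases) (force simp: P_def)+
    then have "clocked s (Mu f) xs = None" by (intro none)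
    with 2 show ?thesis by simp
  next
    case 3
    then have "clocked s (Mu f) xs = Some z" by (simp only: iff)
    with 3 show ?thesis by simp
  qed
  then show ?thesis by (simp only: S_def)
qed

text \<open>The program \<open>r\<close> is fixed, so a program for its clocked version is assembled
  along the structure of \<open>r\<close>, with no coding of programs as numbers. The clock becomes
  an additional first argument, and \<open>n\<close> stays arbitrary because subprograms run at
  other arities.\<close>

lemma total_rec_clocked:
  "total_rec (Suc n) (\<lambda>xs. option_code (clocked (hd xs) r (tl xs)))"
proof (induction r arbitrary: n)
  case Zero
  show ?case by (simp add: total_rec_const)
next
  case Succ
  show ?case
  proof (cases "n = 1")
    case True
    have "total_rec (Suc n) (\<lambda>xs. Suc (Suc (xs ! 1)))"
      using True by (intro total_rec_intros) auto
    then show ?thesis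
      by (rule total_rec_cong) (auto simp: True length_Suc_conv)
  next
    case False
    show ?thesis
      by (rule total_rec_cong[OF total_rec_const[of _ 0]])
        (use False in \<open>auto simp: length_Suc_conv split: list.splits\<close>)
  qed
next
  case (Proj i)
  show ?case
  proof (cases "i < n")
    case True
    have "total_rec (Suc n) (\<lambda>xs. Suc (xs ! Suc i))"
      using True by (intro total_rec_intros) auto
    then show ?thesis
      by (rule total_rec_cong) (auto simp: True nth_tl)
  next
    case False
    show ?thesis
      by (rule total_rec_cong[OF total_rec_const[of _ 0]]) (use False in auto)
  qed
next
  case (Comp f gs)
  \<comment> \<open>Stated for lists \<open>hs\<close> inside \<open>gs\<close> so that the list can
    be induced on while the induction hypothesis for members of \<open>gs\<close> stays
    available.\<close>
  have defined: "rec_pred (Suc n) (\<lambda>xs. \<forall>g\<in>set hs. clocked (hd xs) g (tl xs) \<noteq> None)"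
    if "set hs \<subseteq> set gs" for hs
    using that
  proof (induction hs)
    case Nil
    show ?case by (simp add: rec_pred_def total_rec_const)
  next
    case (Cons h hs)
    have "rec_pred (Suc n) (\<lambda>xs. option_code (clocked (hd xs) h (tl xs)) \<noteq> 0)"
      using Cons.prems by (intro total_rec_intros Comp.IH(2)) auto
    moreover have "option_code v \<noteq> 0 \<longleftrightarrow> v \<noteq> None" for v by (cases v) auto
    ultimately have "rec_pred (Suc n) (\<lambda>xs. clocked (hd xs) h (tl xs) \<noteq> None)" by simp
    from rec_pred_conj[OF this Cons.IH] Cons.prems show ?case by simp
  qed
  \<comment> \<open>Decoding by \<open>- 1\<close> sends an undefined argument to 0; the test
    \<open>defined\<close> screens out that case.\<close>
  define hs where "hs = (\<lambda>xs. xs ! 0) #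
      map (\<lambda>g xs. option_code (clocked (hd xs) g (tl xs)) - 1) gs"
  have "\<forall>h\<in>set hs. total_rec (Suc n) h"
    unfolding hs_def by (auto intro!: total_rec_intros Comp.IH(2))
  then have "total_rec (Suc n) (\<lambda>xs. (\<lambda>ys. option_code (clocked (hd ys) f (tl ys)))
      (map (\<lambda>h. h xs) hs))"
    by (intro total_rec_Comp) (use Comp.IH(1)[of "length gs"] in \<open>simp_all add: hs_def\<close>)
  from total_rec_if[OF defined[OF subset_refl] this total_rec_const[of _ 0]] show ?case
  proof (rule total_rec_cong)
    fix xs :: "nat list" assume "length xs = Suc n"
    then obtain s ys where xs: "xs = s # ys" by (auto simp: length_Suc_conv)
    show "(if \<forall>g\<in>set gs. clocked (hd xs) g (tl xs) \<noteq> None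
          then option_code (clocked (hd (map (\<lambda>h. h xs) hs)) f (tl (map (\<lambda>h. h xs) hs))) else 0) =
        option_code (clocked (hd xs) (Comp f gs) (tl xs))"
    proof (cases "\<forall>g\<in>set gs. clocked s g ys \<noteq> None")
      case True
      then have "map (\<lambda>g. option_code (clocked s g ys) - 1) gs = map (\<lambda>g. the (clocked s g ys)) gs"
        by auto
      moreover have "None \<notin> set (map (\<lambda>g. clocked s g ys) gs)"
        using True by force
      ultimately show ?thesis
        using True by (simp add: xs hs_def Let_def comp_def cong: map_cong)
    next
      case False
      then have "None \<in> set (map (\<lambda>g. clocked s g ys) gs)" by force
      with False show ?thesis by (auto simp: xs Let_def)
    qed
  qed
next
  case (PrimRec f g)
  show ?case
  proof (cases n)
    case 0
    show ?thesis
      by (rule total_rec_cong[OF total_rec_const[of _ 0]])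
        (auto simp: 0 length_Suc_conv)
  next
    case (Suc m)
    \<comment> \<open>\<open>F\<close> receives the clock, the recursion argument and the
      parameters. \<open>G\<close> receives the counter, the coded previous value and then the same
      list, hence the positions 0, 1, 2 and the tail from 4.\<close>
    define F where "F xs = option_code (clocked (xs ! 0) f (tl (tl xs)))" for xs
    define G where "G ys = (if ys ! 1 = 0 then 0
        else option_code (clocked (ys ! 2) g (ys ! 0 # (ys ! 1 - 1) # drop 4 ys)))" for ys
    have "total_rec (Suc n) (\<lambda>xs. (\<lambda>ys. option_code (clocked (hd ys) f (tl ys)))
        (map (\<lambda>h. h xs) ((\<lambda>xs. xs ! 0) # map (\<lambda>i xs. xs ! (i + 2)) [0..<m])))"
      using PrimRec.IH(1)[of m] Suc by (intro total_rec_Comp) (auto intro: total_rec_proj)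
    then have F: "total_rec (Suc n) F"
    proof (rule total_rec_cong)
      fix xs :: "nat list" assume "length xs = Suc n"
      then obtain a b ys where "xs = a # b # ys" "length ys = m"
        by (auto simp: Suc length_Suc_conv)
      moreover from this have "map (\<lambda>i. ys ! i) [0..<m] = ys" by (auto intro: nth_equalityI)
      ultimately show "(\<lambda>ys. option_code (clocked (hd ys) f (tl ys)))
          (map (\<lambda>h. h xs) ((\<lambda>xs. xs ! 0) # map (\<lambda>i xs. xs ! (i + 2)) [0..<m])) = F xs"
        by (simp add: F_def comp_def)
    qed
    have "total_rec (Suc (Suc (Suc n))) (\<lambda>xs. (\<lambda>ys. option_code (clocked (hd ys) g (tl ys)))
        (map (\<lambda>h. h xs) ([\<lambda>xs. xs ! 2, \<lambda>xs. xs ! 0, \<lambda>xs. xs ! 1 - 1] @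
          map (\<lambda>i xs. xs ! (i + 4)) [0..<m])))"
      using PrimRec.IH(2)[of "Suc (Suc m)"] Suc
      by (intro total_rec_Comp) (auto intro!: total_rec_intros)
    then have "total_rec (Suc (Suc (Suc n))) (\<lambda>xs. if xs ! 1 = 0 then 0 else
        (\<lambda>ys. option_code (clocked (hd ys) g (tl ys)))
        (map (\<lambda>h. h xs) ([\<lambda>xs. xs ! 2, \<lambda>xs. xs ! 0, \<lambda>xs. xs ! 1 - 1] @
          map (\<lambda>i xs. xs ! (i + 4)) [0..<m])))"
      by (intro total_rec_intros) auto
    then have G: "total_rec (Suc (Suc (Suc n))) G"
    proof (rule total_rec_cong)
      fix xs :: "nat list" assume "length xs = Suc (Suc (Suc n))"
      then obtain a b c d ys where "xs = a # b # c # d # ys" "length ys = m"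
        by (auto simp: Suc length_Suc_conv)
      moreover from this have "map (\<lambda>i. ys ! i) [0..<m] = ys" by (auto intro: nth_equalityI)
      ultimately show "(if xs ! 1 = 0 then 0 else
          (\<lambda>ys. option_code (clocked (hd ys) g (tl ys)))
          (map (\<lambda>h. h xs) ([\<lambda>xs. xs ! 2, \<lambda>xs. xs ! 0, \<lambda>xs. xs ! 1 - 1] @
            map (\<lambda>i xs. xs ! (i + 4)) [0..<m]))) = G xs"
        by (simp add: G_def comp_def)
    qed
    have "total_rec (Suc n) (\<lambda>xs. rec_nat (F xs) (\<lambda>k v. G (k # v # xs)) (xs ! 1))"
      by (intro total_rec_rec_nat F G total_rec_proj) (simp add: Suc)
    then show ?thesis
    proof (rule total_rec_cong)
      fix xs :: "nat list" assume "length xs = Suc n"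
      then obtain s k ys where xs: "xs = s # k # ys" "length ys = m"
        by (auto simp: Suc length_Suc_conv)
      \<comment> \<open>The recursion argument \<open>j\<close> stays fixed inside the list while
        the induction runs over the number \<open>i\<close> of rounds.\<close>
      have "rec_nat (F (s # j # ys)) (\<lambda>k v. G (k # v # s # j # ys)) i =
          option_code (clocked s (PrimRec f g) (i # ys))" for i j
        by (induction i) (auto simp: F_def G_def split: option.splits bind_splits)
      then show "rec_nat (F xs) (\<lambda>k v. G (k # v # xs)) (xs ! 1) =
          option_code (clocked (hd xs) (PrimRec f g) (tl xs))"
        by (simp add: xs)
    qed
  qed
next
  case (Mu f)
  \<comment> \<open>The list holds the candidate, the search state, the clock and then the
    arguments.\<close>
  define D where "D ys = option_code (clocked (ys ! 2) f (ys ! 0 # drop 3 ys))" for ys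
  have "total_rec (Suc (Suc (Suc n))) (\<lambda>xs. (\<lambda>ys. option_code (clocked (hd ys) f (tl ys)))
      (map (\<lambda>h. h xs) ([\<lambda>xs. xs ! 2, \<lambda>xs. xs ! 0] @ map (\<lambda>i xs. xs ! (i + 3)) [0..<n])))"
    using Mu.IH[of "Suc n"] by (intro total_rec_Comp) (auto intro!: total_rec_intros)
  then have D: "total_rec (Suc (Suc (Suc n))) D"
  proof (rule total_rec_cong)
    fix xs :: "nat list" assume "length xs = Suc (Suc (Suc n))"
    then obtain a b c ys where "xs = a # b # c # ys" "length ys = n"
      by (auto simp: length_Suc_conv)
    moreover from this have "map (\<lambda>i. ys ! i) [0..<n] = ys" by (auto intro: nth_equalityI)
    ultimately show "(\<lambda>ys. option_code (clocked (hd ys) f (tl ys)))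
        (map (\<lambda>h. h xs) ([\<lambda>xs. xs ! 2, \<lambda>xs. xs ! 0] @ map (\<lambda>i xs. xs ! (i + 3)) [0..<n])) = D xs"
      by (simp add: D_def comp_def)
  qed
  have "total_rec (Suc n) (\<lambda>xs. rec_nat 0 (\<lambda>k v. (\<lambda>ys. if ys ! 1 \<noteq> 0 then ys ! 1
      else if D ys = 0 then 1 else if D ys = 1 then ys ! 0 + 2 else 0) (k # v # xs)) (xs ! 0) - 1)"
    by (intro total_rec_intros total_rec_rec_nat D) auto
  then show ?case
  proof (rule total_rec_cong)
    fix xs :: "nat list" assume "length xs = Suc n"
    then obtain s ys where xs: "xs = s # ys" by (auto simp: length_Suc_conv)
    show "rec_nat 0 (\<lambda>k v. (\<lambda>ys. if ys ! 1 \<noteq> 0 then ys ! 1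
        else if D ys = 0 then 1 else if D ys = 1 then ys ! 0 + 2 else 0) (k # v # xs)) (xs ! 0) - 1 =
        option_code (clocked (hd xs) (Mu f) (tl xs))"
      unfolding xs list.sel option_code_clocked_Mu by (simp add: D_def cong: if_cong)
  qed
qed


section \<open>Effective choice of a point in the domain\<close>

lemma clocked_call_total:
  assumes "total_rec n f" "\<forall>g\<in>set gs. total_rec n g"
  shows "total_rec n (\<lambda>xs. option_code (clocked (f xs) r (map (\<lambda>g. g xs) gs)))"
  using total_rec_Comp[of "f # gs" "\<lambda>ys. option_code (clocked (hd ys) r (tl ys))" n]
    total_rec_clocked[of "length gs" r] assms by simp

text \<open>Minimising directly over \<open>m\<close> would hang at the first undefined value. The
  search instead runs over codes of pairs of a candidate and a clock, with a total test, and so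
  dovetails all computations.\<close>

lemma computable_selection:
  obtains p where
    "\<And>e m. eval p [e] = Some m \<Longrightarrow> e < m \<and> eval r [e, m] \<noteq> None"
    "\<And>e m. e < m \<Longrightarrow> eval r [e, m] \<noteq> None \<Longrightarrow> eval p [e] \<noteq> None"
proof -
  define P where "P e t \<longleftrightarrow> e < fst (prod_decode t) \<and>
    option_code (clocked (snd (prod_decode t)) r [e, fst (prod_decode t)]) \<noteq> 0" for e t
  have "total_rec 2 (\<lambda>xs. option_code (clocked (snd (prod_decode (xs ! 0))) r
      (map (\<lambda>g. g xs) [\<lambda>xs. xs ! 1, \<lambda>xs. fst (prod_decode (xs ! 0))])))"
    by (intro clocked_call_total) (auto intro!: total_rec_intros total_rec_prod_decode)
  then have "rec_pred 2 (\<lambda>xs. \<not> P (xs ! 1) (xs ! 0))"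
    unfolding P_def by (intro total_rec_intros total_rec_prod_decode) auto
  then obtain R where R: "\<And>xs. length xs = 2 \<Longrightarrow> eval R xs = Some (of_bool (\<not> P (xs ! 1) (xs ! 0)))"
    unfolding rec_pred_def total_rec_def by auto
  have "total_rec 1 (\<lambda>xs. fst (prod_decode (xs ! 0)))"
    by (intro total_rec_prod_decode total_rec_intros) auto
  then obtain F where F: "\<And>t. eval F [t] = Some (fst (prod_decode t))"
    unfolding total_rec_def by (metis One_nat_def length_Cons list.size(3) nth_Cons_0)
  show ?thesis
  proof
    fix e m assume m: "eval (Comp F [Mu R]) [e] = Some m"
    then obtain t where t: "eval (Mu R) [e] = Some t" "m = fst (prod_decode t)"
      by (cases "eval (Mu R) [e]") (auto simp: F Let_def simp del: eval.simps(6))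
    then have "P e t" unfolding eval_Mu_eq_Some_iff by (auto simp: R)
    then show "e < m \<and> eval r [e, m] \<noteq> None"
      unfolding P_def t(2) by (auto dest: clocked_sound split: option.splits)
  next
    fix e m assume em: "e < m" "eval r [e, m] \<noteq> None"
    then obtain v where "eval r [e, m] = Some v" by auto
    from eventually_happens[OF clocked_complete[OF this]]
    obtain s where "clocked s r [e, m] = Some v" by auto
    then have "P e (prod_encode (m, s))" using em by (simp add: P_def)
    then show "eval (Comp F [Mu R]) [e] \<noteq> None"
      by (auto simp: F R Let_def)
  qed
qed


section \<open>The separating class\<close>

lemma total_computable_iff: "f \<in> total_computable \<longleftrightarrow> total_rec 1 (\<lambda>xs. f (xs ! 0))"
proof -
  have "(\<forall>xs. length xs = 1 \<longrightarrow> eval r xs = Some (f (xs ! 0))) \<longleftrightarrow> (\<forall>x. eval r [x] = Some (f x))" for r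
    by (auto simp: length_Suc_conv)
  then show ?thesis
    by (simp add: total_computable_def partial_computable_def total_rec_def)
qed

text \<open>The binary digits 1 stand exactly at the positions from \<open>e\<close> to
  \<open>m - 1\<close>. The closed form makes the code computable from the endpoints.\<close>

lemma set_encode_atLeastLessThan: "e \<le> m \<Longrightarrow> set_encode {e..<m} = 2 ^ m - 2 ^ e"
proof (induction m rule: dec_induct)
  case (step m)
  then have "{e..<Suc m} = insert m {e..<m}" by auto
  moreover have "(2::nat) ^ e \<le> 2 ^ m" using step by simp
  ultimately show ?case using step by simp
qed simp

lemma finite_content_upto: "finite (content_upto T n)"
  unfolding content_upto_def vimage_def[symmetric] by (intro finite_vimageI) auto

lemma content_upto_subset: "content_upto T n \<subseteq> content T"
  by (auto simp: content_upto_def content_def)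

lemma eventually_in_content_upto:
  assumes "x \<in> content T"
  shows "\<forall>\<^sub>F n in sequentially. x \<in> content_upto T n"
proof -
  from assms obtain j where "T j = Some x" by (auto simp: content_def)
  then have "x \<in> content_upto T n" if "n > j" for n
    using that by (force simp: content_upto_def)
  then show ?thesis by (auto intro: eventually_mono[OF eventually_gt_at_top[of j]])
qed

lemma Ex_C_I:
  assumes "\<forall>\<^sub>F n in sequentially. p n = Some e" "C_index \<phi> e" "C \<phi> e = content T"
  shows "Ex_C \<phi> p T"
  using assms unfolding Ex_C_def eventually_sequentially by (metis order_refl)

theorem theorem11:
  fixes \<phi> :: "nat \<Rightarrow> nat \<Rightarrow> nat option"
  assumes "acceptable_numbering \<phi>"
  shows "learnable_REC (CInd \<phi>) Psd (Ex_C \<phi>) - learnable_REC unrestricted Sd (Bc_W \<phi>) \<noteq> {}"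
proof -
  have range: "range \<phi> = partial_computable"
    and translate: "\<And>\<psi>. \<psi> \<in> partial_computable2 \<Longrightarrow> \<exists>f\<in>total_computable. \<forall>e. \<phi> (f e) = \<psi> e"
    using assms unfolding acceptable_numbering_def by blast+
  obtain u where u: "\<And>e x. eval u [e, x] = \<phi> e x"
    using assms unfolding acceptable_numbering_def partial_computable2_def by auto

  \<comment> \<open>The search and the class\<close>
  have "total_rec 2 (\<lambda>xs. 2 ^ (xs ! 1) - 2 ^ (xs ! 0))"
    by (intro total_rec_intros total_rec_power2) auto
  then obtain c where c: "\<And>e m. eval c [e, m] = Some (2 ^ m - 2 ^ e)"
    unfolding total_rec_def
    by (metis One_nat_def length_Cons list.size(3) nth_Cons_0 nth_Cons_Suc numeral_2_eq_2)
  \<comment> \<open>The inner call runs \<open>\<phi> e\<close> as a learner on the data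
    \<open>{e..<m}\<close>; the outer call runs its hypothesis on \<open>m\<close>. For
    \<open>e < m\<close>, definedness thus means that the hypothesis enumerates
    \<open>m\<close>.\<close>
  define q where "q = Comp u [Comp u [Proj 0, c], Proj 1]"
  have q: "eval q [e, m] = Option.bind (\<phi> e (set_encode {e..<m})) (\<lambda>a. \<phi> a m)" if "e < m" for e m
    using that by (cases "\<phi> e (2 ^ m - 2 ^ e)")
      (auto simp: q_def Let_def u c set_encode_atLeastLessThan)
  obtain N where N: "\<And>e m. eval N [e] = Some m \<Longrightarrow> e < m \<and> eval q [e, m] \<noteq> None"
    and N': "\<And>e m. e < m \<Longrightarrow> eval q [e, m] \<noteq> None \<Longrightarrow> eval N [e] \<noteq> None"
    using computable_selection[of q] by metis
  define \<L> where "\<L> = {L. \<exists>e. L = {e..} \<or> (\<exists>m. eval N [e] = Some m \<and> L = {e..<m})}"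

  have REC: "\<L> \<subseteq> REC"
  proof
    fix L assume "L \<in> \<L>"
    moreover have "rec_pred 1 (\<lambda>xs. xs ! 0 \<in> {e..})" for e
      by (simp, intro total_rec_intros) auto
    moreover have "rec_pred 1 (\<lambda>xs. xs ! 0 \<in> {e..<m})" for e m
      by (simp, intro total_rec_intros) auto
    ultimately show "L \<in> REC"
      unfolding \<L>_def REC_def rec_pred_def by (auto simp: total_computable_iff)
  qed

  text \<open>The hypothesis coded by \<open>(e, 0)\<close> is \<open>{e..}\<close>, and the one coded by \<open>(e, m)\<close>
    with \<open>m > 0\<close> is \<open>{e..<m}\<close>.\<close>
  define \<psi> where "\<psi> a x = Some (of_bool (fst (prod_decode a) \<le> x \<and>
    (snd (prod_decode a) = 0 \<or> x < snd (prod_decode a))) :: nat)" for a x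
  have "rec_pred 2 (\<lambda>xs. fst (prod_decode (xs ! 0)) \<le> xs ! 1 \<and>
    (snd (prod_decode (xs ! 0)) = 0 \<or> xs ! 1 < snd (prod_decode (xs ! 0))))"
    by (intro total_rec_intros total_rec_prod_decode) auto
  then obtain r where r: "\<And>xs. length xs = 2 \<Longrightarrow> eval r xs = \<psi> (xs ! 0) (xs ! 1)"
    unfolding rec_pred_def total_rec_def \<psi>_def by blast
  have "\<psi> \<in> partial_computable2"
    unfolding partial_computable2_def using r[of "[_, _]"] by auto
  then obtain f where f: "f \<in> total_computable" "\<And>a. \<phi> (f a) = \<psi> a"
    using translate by metis
  have C_index_f: "C_index \<phi> (f a)" for a
    by (auto simp: C_index_def f \<psi>_def)
  have C_f0: "C \<phi> (f (prod_encode (e, 0))) = {e..}" for e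
    by (auto simp: C_def f \<psi>_def)
  have C_f: "C \<phi> (f (prod_encode (e, m))) = {e..<m}" if "m > 0" for e m
    using that by (auto simp: C_def f \<psi>_def)

  \<comment> \<open>The partially set-driven learner\<close>
  \<comment> \<open>The disjunct \<open>d = 0\<close> lets the search succeed on the empty set as
    well, so that every data set yields a hypothesis, as the global requirement demands.\<close>
  define least where "least d = (LEAST k. d = 0 \<or> k \<in> set_decode d)" for d
  \<comment> \<open>The value is \<open>m + 1\<close> if \<open>N\<close> finds \<open>m\<close>
    within the clock \<open>i\<close>, and 0 if it has found nothing yet.\<close>
  define stop where "stop i e = option_code (clocked i N [e])" for i e
  define guess where "guess p =
    (let d = fst (prod_decode p); i = snd (prod_decode p); v = stop i (least d)
     in if v = 0 \<or> v - 1 \<in> set_decode d then prod_encode (least d, 0)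
        else prod_encode (least d, v - 1))" for p
  define h where "h p = Some (f (guess p))" for p

  have "rec_pred (Suc 1) (\<lambda>ys. ys ! 1 = 0 \<or> ys ! 0 \<in> set_decode (ys ! 1))"
    by (intro total_rec_intros rec_pred_bit) auto
  moreover have "\<exists>k. d = 0 \<or> k \<in> set_decode d" for d
    using set_decode_inverse[of d] by (metis all_not_in_conv set_encode_empty)
  ultimately have "total_rec 1 (\<lambda>xs. LEAST k. (k # xs) ! 1 = 0 \<or> (k # xs) ! 0 \<in> set_decode ((k # xs) ! 1))"
    by (intro total_rec_Least) auto
  then have "total_rec 1 (\<lambda>xs. least (xs ! 0))" by (simp add: least_def)
  note total_least = total_rec_unary[OF this]
  have total_stop: "total_rec n (\<lambda>xs. stop (f1 xs) (f2 xs))" if "total_rec n f1" "total_rec n f2" for n f1 f2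
    using clocked_call_total[of n f1 "[f2]" N] that by (simp add: stop_def)
  have d: "total_rec 1 (\<lambda>xs. fst (prod_decode (xs ! 0)))"
    and i: "total_rec 1 (\<lambda>xs. snd (prod_decode (xs ! 0)))"
    by (auto intro!: total_rec_prod_decode total_rec_proj)
  note e = total_least[OF d]
  note v = total_stop[OF i e]
  have "total_rec 1 (\<lambda>xs. guess (xs ! 0))"
    unfolding guess_def Let_def
    by (intro total_rec_if rec_pred_disj rec_pred_eq rec_pred_bit total_rec_prod_encode
        total_rec_diff total_rec_const d e v)
  from total_rec_unary[OF f(1)[unfolded total_computable_iff] this]
  have "total_rec 1 (\<lambda>xs. f (guess (xs ! 0)))" .
  then have h: "h \<in> partial_computable"
    using total_computable_iff[of "\<lambda>p. f (guess p)"] unfolding h_def total_computable_def by simp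

  have Psd_h: "Psd h T n = Some (f (let e = least (set_encode (content_upto T n)); v = stop n e in
      if v = 0 \<or> v - 1 \<in> content_upto T n then prod_encode (e, 0) else prod_encode (e, v - 1)))"
    for T n
    by (simp add: Psd_def h_def guess_def Let_def set_encode_inverse finite_content_upto)

  have "learns (CInd \<phi>) Psd (Ex_C \<phi>) h L" if L: "L \<in> \<L>" for L
    unfolding learns_def
  proof (intro conjI allI impI)
    fix T show "CInd \<phi> (Psd h T) T"
      unfolding CInd_def Psd_h using C_index_f by blast
  next
    fix T assume T: "content T = L"
    obtain e where e: "L = {e..} \<or> (\<exists>m. eval N [e] = Some m \<and> L = {e..<m})"
      using L unfolding \<L>_def by blast
    \<comment> \<open>In the finite case \<open>N\<close> gives \<open>e < m\<close>, so
      \<open>e\<close> is the minimum of \<open>L\<close> in both cases.\<close>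
    then have eL: "e \<in> L" "L \<subseteq> {e..}" using N by auto
    have least: "\<forall>\<^sub>F n in sequentially. least (set_encode (content_upto T n)) = e"
      using eventually_in_content_upto[of e T, unfolded T, OF eL(1)]
    proof eventually_elim
      case (elim n)
      have sub: "content_upto T n \<subseteq> {e..}" using content_upto_subset[of T n] T eL by blast
      have "set_encode (content_upto T n) \<noteq> 0"
        using elim set_encode_inverse[OF finite_content_upto[of T n]]
        by (metis empty_iff set_decode_zero)
      then have "least (set_encode (content_upto T n)) = (LEAST k. k \<in> content_upto T n)"
        by (simp add: least_def set_encode_inverse finite_content_upto)
      also have "\<dots> = e" by (rule Least_equality) (use elim sub in auto)
      finally show ?case .
    qed
    show "Ex_C \<phi> (Psd h T) T"
    proof (cases "L = {e..}")
      case True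
      have "\<forall>\<^sub>F n in sequentially. Psd h T n = Some (f (prod_encode (e, 0)))"
      proof (cases "eval N [e]")
        case None
        then have "stop n e = 0" for n
          using clocked_sound[of n N "[e]"] by (cases "clocked n N [e]") (auto simp: stop_def)
        with least show ?thesis by (auto simp: Psd_h elim: eventually_mono)
      next
        case (Some m)
        \<comment> \<open>As \<open>m\<close> lies in \<open>{e..}\<close>, it eventually appears in
          the data, and from then on the learner returns to \<open>{e..}\<close> for good.\<close>
        then have "m \<in> L" using N True by (auto simp: less_imp_le)
        from least eventually_in_content_upto[of m T, unfolded T, OF this] clocked_complete[OF Some]
        show ?thesis by eventually_elim (simp add: Psd_h stop_def)
      qed
      then show ?thesis by (rule Ex_C_I) (simp_all add: C_index_f C_f0 True T)
    next
      case False
      then obtain m where m: "eval N [e] = Some m" "L = {e..<m}" using e by blast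
      have notin: "m \<notin> content_upto T n" for n using content_upto_subset[of T n] T m by auto
      from least clocked_complete[OF m(1)]
      have "\<forall>\<^sub>F n in sequentially. Psd h T n = Some (f (prod_encode (e, m)))"
        by eventually_elim (simp add: Psd_h stop_def notin)
      \<comment> \<open>Positivity keeps this code apart from the code of
        \<open>{e..}\<close>.\<close>
      moreover have "m > 0" using N[OF m(1)] by simp
      ultimately show ?thesis by (intro Ex_C_I) (auto simp: C_index_f C_f m T)
    qed
  qed
  with REC h have "\<L> \<in> learnable_REC (CInd \<phi>) Psd (Ex_C \<phi>)"
    unfolding learnable_REC_def by blast

  \<comment> \<open>Failure of every set-driven learner\<close>
  moreover have "\<L> \<notin> learnable_REC unrestricted Sd (Bc_W \<phi>)"
  proof
    assume "\<L> \<in> learnable_REC unrestricted Sd (Bc_W \<phi>)"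
    then obtain g where g: "g \<in> partial_computable"
      and "\<forall>L\<in>\<L>. learns unrestricted Sd (Bc_W \<phi>) g L"
      unfolding learnable_REC_def by blast
    then have learns: "Bc_W \<phi> (Sd g T) T" if "content T \<in> \<L>" for T
      using that unfolding learns_def by simp
    \<comment> \<open>An index of the learner itself serves as the minimum of the set on which it
      fails.\<close>
    from g obtain e where e: "\<phi> e = g" unfolding range[symmetric] by blast
    show False
    proof (cases "eval N [e]")
      case None
      \<comment> \<open>Listing \<open>{e..}\<close> in increasing order makes the observed data
        exactly the intervals that the search inspects.\<close>
      define T where "T k = Some (e + k)" for k
      have T: "content T = {e..}"
        by (auto simp: content_def T_def image_iff le_iff_add)
      have T': "content_upto T n = {e..<e + n}" for n
      proof (intro equalityI subsetI)
        fix x assume "x \<in> {e..<e + n}"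
        then have "Some x = T (x - e)" "x - e < n" by (auto simp: T_def)
        then show "x \<in> content_upto T n" unfolding content_upto_def by blast
      qed (auto simp: content_upto_def T_def)
      have "content T \<in> \<L>" unfolding \<L>_def T by blast
      from learns[OF this] obtain n0 where
        n0: "\<And>n. n \<ge> n0 \<Longrightarrow> \<exists>a. Sd g T n = Some a \<and> W \<phi> a = {e..}"
        unfolding Bc_W_def T by blast
      \<comment> \<open>The successor ensures a nonempty interval even if \<open>n0\<close> is 0,
        since \<open>N'\<close> asks for \<open>e < m\<close>.\<close>
      then obtain a where a: "g (set_encode {e..<e + Suc n0}) = Some a" "W \<phi> a = {e..}"
        unfolding Sd_def T' by (metis le_SucI order_refl)
      have "e + Suc n0 \<in> W \<phi> a" using a by simp
      then have "eval q [e, e + Suc n0] \<noteq> None"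
        using a(1) by (auto simp: q e W_def)
      from N'[OF _ this] None show False by simp
    next
      case (Some m)
      \<comment> \<open>The finite set is listed once and followed by pauses, so its full content is
        reached by stage \<open>m\<close>.\<close>
      define T where "T k = (if e + k < m then Some (e + k) else None)" for k
      have T: "content T = {e..<m}"
      proof (intro equalityI subsetI)
        fix x assume "x \<in> {e..<m}"
        then have "Some x = T (x - e)" by (simp add: T_def)
        then show "x \<in> content T" unfolding content_def by blast
      qed (auto simp: content_def T_def split: if_splits)
      have T': "content_upto T n = {e..<m}" if "n \<ge> m" for n
      proof
        show "content_upto T n \<subseteq> {e..<m}" using content_upto_subset[of T n] T by simp
        show "{e..<m} \<subseteq> content_upto T n"
        proof
          fix x assume "x \<in> {e..<m}"
          then have "Some x = T (x - e)" "x - e < n" using that by (auto simp: T_def)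
          then show "x \<in> content_upto T n" unfolding content_upto_def by blast
        qed
      qed
      have "content T \<in> \<L>" unfolding \<L>_def T using Some by blast
      from learns[OF this] obtain n0 where
        "\<And>n. n \<ge> n0 \<Longrightarrow> \<exists>a. Sd g T n = Some a \<and> W \<phi> a = {e..<m}"
        unfolding Bc_W_def T by blast
      then obtain a where a: "g (set_encode {e..<m}) = Some a" "W \<phi> a = {e..<m}"
        using T'[of "max n0 m"] unfolding Sd_def by (metis max.cobounded1 max.cobounded2)
      \<comment> \<open>The final hypothesis is the one on the full set \<open>{e..<m}\<close>, and
        \<open>m\<close> was selected because that hypothesis enumerates it.\<close>
      from N[OF Some] have "\<phi> a m \<noteq> None" by (auto simp: q e a)
      then have "m \<in> W \<phi> a" by (auto simp: W_def)
      with a show False by simp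
    qed
  qed
  ultimately show ?thesis by blast
qed

end
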